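(* Let $R$ be a unital associative ring (not necessarily commutative), $\mathcal K\subset\mathbb N_{>0}$ a set of positive integers, and $\mathcal A=\bigcup_{k\in\mathcal K}\mathcal A_k$ a partition of a set $\mathcal A$ into non-empty parts indexed by $\mathcal K$. For each $k\in\mathcal K$ let $M^k_1,\dots,M^k_k$ be matrices with rows indexed by $\mathcal A_k$, columns indexed by $\mathcal A$ and entries in $R$, and let $\tilde M^k_i=J-M^k_i$ where $J$ is the all-ones matrix indexed by $\mathcal A_k\times\mathcal A$. For $\alpha\in\mathcal A_k$ let $g_\alpha,\tilde g_\alpha$ be the uniquely defined formal power series consisting only of monomials of degree at least $1$ in $X$ and involving at least one of the variables $Y_\beta$, $\beta\in\mathcal A$, such that $$g_\alpha=Y_\alpha(X-(M^k_1V)_\alpha)(X-(M^k_2V)_\alpha)\cdots(X-(M^k_kV)_\alpha),$$ $$\tilde g_\alpha=Y_\alpha(-X+(\tilde M^k_1\tilde V)_\alpha)\cdots(-X+(\tilde M^k_k\tilde V)_\alpha),$$ where $V=(g_\beta)_{\beta\in\mathcal A}$, $\tilde V=(\tilde g_\beta)_{\beta\in\mathcal A}$ and $(MV)_\alpha=\sum_\beta M(\alpha,\beta)V_\beta$. Set $g=-X+\sum_{\alpha\in\mathcal A}g_\alpha$ and $\tilde g=-X+\sum_{\alpha\in\mathcal A}\tilde g_\alpha$. Then $$g\circ_X\tilde g=\tilde g\circ_X g=X.$$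
   Context: $X$ and $Y_\alpha$ ($\alpha\in\mathcal A$) are non-commuting variables (also not commuting with $R$); formal power series are (possibly infinite) formal sums of monomials $\pm r_1Z_1r_2\cdots r_lZ_lr_{l+1}$ with $r_i\in R$, $Z_i\in\{X\}\cup\{Y_\alpha\}$; the $X$-degree of a monomial is the number of occurrences of $X$. For $f,h$ with every monomial of $h$ of $X$-degree $\geq1$, $f\circ_X h$ is obtained by replacing every occurrence of $X$ in every monomial of $f$ by $h$. *)

theory Defs
  imports Main "HOL-Library.Poly_Mapping" "HOL-Library.FuncSet" "HOL-Library.Disjoint_Sets"
begin

section \<open>Noncommutative polynomials whose variables do not commute with the coefficients\<close>

text \<open>
  A monomial \<open>r\<^sub>1 Z\<^sub>1 r\<^sub>2 Z\<^sub>2 \<dots> r\<^sub>l Z\<^sub>l r\<^sub>l\<^sub>+\<^sub>1\<close> is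
  \<open>MTimes r\<^sub>1 Z\<^sub>1 (MTimes r\<^sub>2 Z\<^sub>2 (\<dots> (MConst r\<^sub>l\<^sub>+\<^sub>1)))\<close>.
  The coefficient ring has sort \<open>{ring, monoid_mult}\<close>, that is, associative and unital.
  The class \<open>ring_1\<close> would in addition exclude the zero ring.
\<close>

datatype ('r, 'x) monomial = MConst 'r | MTimes 'r 'x "('r, 'x) monomial"

primrec mword :: "('r, 'x) monomial \<Rightarrow> 'x list" where
  "mword (MConst r) = []"
| "mword (MTimes r z m) = z # mword m"

primrec mscale :: "'r::monoid_mult \<Rightarrow> ('r, 'x) monomial \<Rightarrow> ('r, 'x) monomial" where
  "mscale r (MConst s) = MConst (r * s)"
| "mscale r (MTimes s z m) = MTimes (r * s) z m"

primrec mmult :: "('r::monoid_mult, 'x) monomial \<Rightarrow> ('r, 'x) monomial \<Rightarrow> ('r, 'x) monomial" where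
  "mmult (MConst r) n = mscale r n"
| "mmult (MTimes r z m) n = MTimes r z (mmult m n)"

lemma mscale_one [simp]: "mscale 1 m = m"
  by (cases m) auto

lemma mscale_mscale: "mscale r (mscale s m) = mscale (r * s) m"
  by (cases m) (auto simp: mult.assoc)

lemma mscale_mmult: "mmult (mscale r m) n = mscale r (mmult m n)"
  by (cases m) (auto simp: mscale_mscale)

lemma mmult_assoc: "mmult (mmult m n) k = mmult m (mmult n k)"
  by (induction m) (auto simp: mscale_mmult)

lemma mmult_one_right: "mmult m (MConst 1) = m"
  by (induction m) auto

lemma mword_mscale [simp]: "mword (mscale r m) = mword m"
  by (cases m) auto

lemma mword_mmult: "mword (mmult m n) = mword m @ mword n"
  by (induction m) auto

text \<open>
  The product of monomials is written additively, because \<^theory>\<open>HOL-Library.Poly_Mapping\<close>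
  builds the monoid ring \<open>\<int>[G]\<close> as the type \<open>G \<Rightarrow>\<^sub>0 int\<close> over an additive monoid \<open>G\<close>
  (which need not be commutative).
\<close>

instantiation monomial :: (monoid_mult, type) monoid_add
begin
definition zero_monomial_def: "0 = MConst 1"
definition plus_monomial_def: "m + n = mmult m n"
instance
  by standard (simp_all add: zero_monomial_def plus_monomial_def mmult_assoc mmult_one_right)
end

text \<open>
  In \<open>\<int>[monomials]\<close>, the coefficient \<open>r + s\<close> and the sum of the coefficients \<open>r\<close> and \<open>s\<close> are still
  distinct; the following two-sided ideal identifies them, so that monomials become
  additive in each of their coefficients.
\<close>

inductive_set coeff_ideal :: "(('r::{ring, monoid_mult}, 'x) monomial \<Rightarrow>\<^sub>0 int) set" where
  gen: "frag_of (MConst (r + s)) - frag_of (MConst r) - frag_of (MConst s) \<in> coeff_ideal"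
| zero: "0 \<in> coeff_ideal"
| diff: "p \<in> coeff_ideal \<Longrightarrow> q \<in> coeff_ideal \<Longrightarrow> p - q \<in> coeff_ideal"
| mult_left: "p \<in> coeff_ideal \<Longrightarrow> a * p \<in> coeff_ideal"
| mult_right: "p \<in> coeff_ideal \<Longrightarrow> p * a \<in> coeff_ideal"

lemma coeff_ideal_uminus: "p \<in> coeff_ideal \<Longrightarrow> - p \<in> coeff_ideal"
  using coeff_ideal.diff[OF coeff_ideal.zero] by fastforce

lemma coeff_ideal_add: "p \<in> coeff_ideal \<Longrightarrow> q \<in> coeff_ideal \<Longrightarrow> p + q \<in> coeff_ideal"
  using coeff_ideal.diff[OF _ coeff_ideal_uminus] by fastforce

text \<open>The free ring \<open>R\<langle>x : 'x\<rangle>\<close>, the variables not commuting with \<open>R\<close>.\<close>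

quotient_type (overloaded) ('r, 'x) ncpoly =
  "('r::{ring, monoid_mult}, 'x) monomial \<Rightarrow>\<^sub>0 int" / "\<lambda>p q. p - q \<in> coeff_ideal"
proof (rule equivpI)
  show "reflp (\<lambda>p q::('r, 'x) monomial \<Rightarrow>\<^sub>0 int. p - q \<in> coeff_ideal)"
    by (simp add: reflp_def coeff_ideal.zero)
  show "symp (\<lambda>p q::('r, 'x) monomial \<Rightarrow>\<^sub>0 int. p - q \<in> coeff_ideal)"
    using coeff_ideal_uminus by (fastforce simp: symp_def)
  show "transp (\<lambda>p q::('r, 'x) monomial \<Rightarrow>\<^sub>0 int. p - q \<in> coeff_ideal)"
  proof (rule transpI)
    fix p q r :: "('r, 'x) monomial \<Rightarrow>\<^sub>0 int"
    assume "p - q \<in> coeff_ideal" "q - r \<in> coeff_ideal"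
    from coeff_ideal_add[OF this] show "p - r \<in> coeff_ideal" by simp
  qed
qed

instantiation ncpoly :: ("{ring, monoid_mult}", type) "{ring, monoid_mult}"
begin

lift_definition zero_ncpoly :: "('a, 'b) ncpoly" is 0 .
lift_definition one_ncpoly :: "('a, 'b) ncpoly" is 1 .
lift_definition plus_ncpoly :: "('a, 'b) ncpoly \<Rightarrow> ('a, 'b) ncpoly \<Rightarrow> ('a, 'b) ncpoly" is "(+)"
proof -
  fix p p' q q' :: "('a, 'b) monomial \<Rightarrow>\<^sub>0 int"
  assume "p - p' \<in> coeff_ideal" "q - q' \<in> coeff_ideal"
  from coeff_ideal_add[OF this] show "p + q - (p' + q') \<in> coeff_ideal"
    by (simp add: algebra_simps)
qed
lift_definition minus_ncpoly :: "('a, 'b) ncpoly \<Rightarrow> ('a, 'b) ncpoly \<Rightarrow> ('a, 'b) ncpoly" is "(-)"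
proof -
  fix p p' q q' :: "('a, 'b) monomial \<Rightarrow>\<^sub>0 int"
  assume "p - p' \<in> coeff_ideal" "q - q' \<in> coeff_ideal"
  from coeff_ideal.diff[OF this] show "p - q - (p' - q') \<in> coeff_ideal"
    by (simp add: algebra_simps)
qed
lift_definition uminus_ncpoly :: "('a, 'b) ncpoly \<Rightarrow> ('a, 'b) ncpoly" is uminus
proof -
  fix p p' :: "('a, 'b) monomial \<Rightarrow>\<^sub>0 int"
  assume "p - p' \<in> coeff_ideal"
  from coeff_ideal_uminus[OF this] show "- p - - p' \<in> coeff_ideal"
    by simp
qed
lift_definition times_ncpoly :: "('a, 'b) ncpoly \<Rightarrow> ('a, 'b) ncpoly \<Rightarrow> ('a, 'b) ncpoly" is "(*)"
proof -
  fix p p' q q' :: "('a, 'b) monomial \<Rightarrow>\<^sub>0 int"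
  assume "p - p' \<in> coeff_ideal" "q - q' \<in> coeff_ideal"
  then have "(p - p') * q + p' * (q - q') \<in> coeff_ideal"
    by (intro coeff_ideal_add coeff_ideal.mult_left coeff_ideal.mult_right)
  then show "p * q - p' * q' \<in> coeff_ideal"
    by (simp add: algebra_simps)
qed

instance
  by standard (transfer; simp add: algebra_simps coeff_ideal.zero)+

end

text \<open>
  The component of \<open>R\<langle>x : 'x\<rangle>\<close> spanned by the monomials with underlying word \<open>w\<close>
  (a copy of the tensor power of \<open>R\<close> with \<open>length w + 1\<close> factors over \<open>\<int>\<close>).
\<close>

definition word_part :: "'x list \<Rightarrow> ('r::{ring, monoid_mult}, 'x) ncpoly set" where
  "word_part w = abs_ncpoly ` {p. \<forall>m \<in> Poly_Mapping.keys p. mword m = w}"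

lemma word_part_zero [simp]: "0 \<in> word_part w"
  unfolding word_part_def zero_ncpoly_def by (auto intro!: imageI)

lemma frag_of_word_part: "mword m = w \<Longrightarrow> abs_ncpoly (frag_of m) \<in> word_part w"
  unfolding word_part_def by (auto intro!: imageI)

lemma one_ncpoly_eq: "1 = abs_ncpoly (frag_of (MConst 1))"
  by (simp add: one_ncpoly_def zero_monomial_def[symmetric])

lemma word_part_add: "p \<in> word_part w \<Longrightarrow> q \<in> word_part w \<Longrightarrow> p + q \<in> word_part w"
  unfolding word_part_def
  by (auto simp: plus_ncpoly.abs_eq intro!: imageI dest!: subsetD[OF keys_add])

lemma word_part_minus: "p \<in> word_part w \<Longrightarrow> q \<in> word_part w \<Longrightarrow> p - q \<in> word_part w"
  unfolding word_part_def
  by (auto simp: minus_ncpoly.abs_eq intro!: imageI dest!: subsetD[OF keys_diff])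

lemma word_part_uminus: "p \<in> word_part w \<Longrightarrow> - p \<in> word_part w"
  using word_part_minus[OF word_part_zero] by fastforce

lemma word_part_mult: "p \<in> word_part v \<Longrightarrow> q \<in> word_part w \<Longrightarrow> p * q \<in> word_part (v @ w)"
  unfolding word_part_def
  by (auto simp: times_ncpoly.abs_eq plus_monomial_def mword_mmult intro!: imageI dest!: subsetD[OF keys_mult])

lemma word_part_sum: "(\<And>i. i \<in> I \<Longrightarrow> F i \<in> word_part w) \<Longrightarrow> sum F I \<in> word_part w"
  by (induction I rule: infinite_finite_induct) (auto intro: word_part_add)


section \<open>Formal power series\<close>

text \<open>
  A formal power series is a possibly infinite formal sum of monomials; for every word \<open>w\<close> it has
  finitely many monomials with underlying word \<open>w\<close>, whose sum is \<open>coeff f w\<close>.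
\<close>

typedef (overloaded) ('r, 'x) ncfps =
  "{f :: 'x list \<Rightarrow> ('r::{ring, monoid_mult}, 'x) ncpoly. \<forall>w. f w \<in> word_part w}"
  morphisms coeff Abs_ncfps
  by (rule exI[of _ "\<lambda>_. 0"]) simp

setup_lifting type_definition_ncfps

lemma ncfps_eqI: "(\<And>w. coeff f w = coeff g w) \<Longrightarrow> f = g"
  by (metis coeff_inject ext)

lemma coeff_word_part: "coeff f w \<in> word_part w"
  using coeff[of f] by simp

lift_definition const :: "'r::{ring, monoid_mult} \<Rightarrow> ('r, 'x) ncfps" is
  "\<lambda>r w. if w = [] then abs_ncpoly (frag_of (MConst r)) else 0"
  by (simp add: frag_of_word_part)

lift_definition var :: "'x \<Rightarrow> ('r::{ring, monoid_mult}, 'x) ncfps" is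
  "\<lambda>z w. if w = [z] then abs_ncpoly (frag_of (MTimes 1 z (MConst 1))) else 0"
  by (simp add: frag_of_word_part)

instantiation ncfps :: ("{ring, monoid_mult}", type) "{ring, monoid_mult}"
begin

lift_definition zero_ncfps :: "('a, 'b) ncfps" is "\<lambda>_. 0" by simp
lift_definition one_ncfps :: "('a, 'b) ncfps" is "\<lambda>w. if w = [] then 1 else 0"
  by (simp add: one_ncpoly_eq frag_of_word_part)
lift_definition plus_ncfps :: "('a, 'b) ncfps \<Rightarrow> ('a, 'b) ncfps \<Rightarrow> ('a, 'b) ncfps" is
  "\<lambda>f g w. f w + g w" by (simp add: word_part_add)
lift_definition minus_ncfps :: "('a, 'b) ncfps \<Rightarrow> ('a, 'b) ncfps \<Rightarrow> ('a, 'b) ncfps" is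
  "\<lambda>f g w. f w - g w" by (simp add: word_part_minus)
lift_definition uminus_ncfps :: "('a, 'b) ncfps \<Rightarrow> ('a, 'b) ncfps" is
  "\<lambda>f w. - f w" by (simp add: word_part_uminus)
lift_definition times_ncfps :: "('a, 'b) ncfps \<Rightarrow> ('a, 'b) ncfps \<Rightarrow> ('a, 'b) ncfps" is
  "\<lambda>f g w. \<Sum>i\<le>length w. f (take i w) * g (drop i w)"
  by (intro allI word_part_sum) (metis append_take_drop_id word_part_mult)

instance
proof
  fix f g h :: "('a, 'b) ncfps"
  show "f + g + h = f + (g + h)" by transfer (simp add: algebra_simps)
  show "f + g = g + f" by transfer (simp add: algebra_simps)
  show "0 + f = f" by transfer simp
  show "- f + f = 0" by transfer simp
  show "f - g = f + - g" by transfer simp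
  show "(f + g) * h = f * h + g * h" by transfer (simp add: algebra_simps sum.distrib)
  show "f * (g + h) = f * g + f * h" by transfer (simp add: algebra_simps sum.distrib)
  show "1 * f = f"
  proof (transfer, rule ext)
    fix f :: "'b list \<Rightarrow> ('a, 'b) ncpoly" and w :: "'b list"
    have "(\<Sum>i\<le>length w. (if take i w = [] then 1 else 0) * f (drop i w)) =
      (\<Sum>i\<le>length w. if i = 0 then f w else 0)"
      by (rule sum.cong) auto
    then show "(\<Sum>i\<le>length w. (if take i w = [] then 1 else 0) * f (drop i w)) = f w" by simp
  qed
  show "f * 1 = f"
  proof (transfer, rule ext)
    fix f :: "'b list \<Rightarrow> ('a, 'b) ncpoly" and w :: "'b list"
    have "(\<Sum>i\<le>length w. f (take i w) * (if drop i w = [] then 1 else 0)) =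
      (\<Sum>i\<le>length w. if i = length w then f w else 0)"
      by (rule sum.cong) auto
    then show "(\<Sum>i\<le>length w. f (take i w) * (if drop i w = [] then 1 else 0)) = f w" by simp
  qed
  show "f * g * h = f * (g * h)"
  proof (transfer, rule ext)
    fix f g h :: "'b list \<Rightarrow> ('a, 'b) ncpoly" and w :: "'b list"
    let ?n = "length w"
    have "(\<Sum>j\<le>?n. (\<Sum>i\<le>length (take j w). f (take i (take j w)) * g (drop i (take j w))) * h (drop j w))
      = (\<Sum>j\<le>?n. \<Sum>i\<le>j. f (take i w) * g (drop i (take j w)) * h (drop j w))"
      by (intro sum.cong) (auto simp: sum_distrib_right min_def)
    also have "\<dots> = (\<Sum>(j, i)\<in>(SIGMA j:{..?n}. {..j}). f (take i w) * g (drop i (take j w)) * h (drop j w))"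
      by (rule sum.Sigma) auto
    also have "\<dots> = (\<Sum>(i, k)\<in>(SIGMA i:{..?n}. {..?n - i}).
        f (take i w) * (g (take k (drop i w)) * h (drop k (drop i w))))"
      by (rule sum.reindex_bij_witness[where i = "\<lambda>(i, k). (i + k, i)" and j = "\<lambda>(j, i). (i, j - i)"])
        (auto simp: drop_take mult.assoc)
    also have "\<dots> = (\<Sum>i\<le>?n. \<Sum>k\<le>?n - i. f (take i w) * (g (take k (drop i w)) * h (drop k (drop i w))))"
      by (rule sum.Sigma[symmetric]) auto
    also have "\<dots> = (\<Sum>i\<le>?n. f (take i w) * (\<Sum>k\<le>length (drop i w). g (take k (drop i w)) * h (drop k (drop i w))))"
      by (simp add: sum_distrib_left)
    finally show "(\<Sum>j\<le>?n. (\<Sum>i\<le>length (take j w). f (take i (take j w)) * g (drop i (take j w))) * h (drop j w))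
      = (\<Sum>i\<le>?n. f (take i w) * (\<Sum>k\<le>length (drop i w). g (take k (drop i w)) * h (drop k (drop i w))))" .
  qed
qed

end

text \<open>
  The sum of a possibly infinite family of series that is locally finite, i.e. for every word \<open>w\<close>
  only finitely many members of the family have monomials with underlying word \<open>w\<close>.
  (For families that are not locally finite the value is meaningless.)
\<close>

lift_definition formal_sum :: "('i \<Rightarrow> ('r::{ring, monoid_mult}, 'x) ncfps) \<Rightarrow> 'i set \<Rightarrow> ('r, 'x) ncfps" is
  "\<lambda>F I w. \<Sum>i \<in> {i \<in> I. F i w \<noteq> 0}. F i w"
  by (auto intro: word_part_sum)


lemma coeff_const: "coeff (const r) w = (if w = [] then abs_ncpoly (frag_of (MConst r)) else 0)"
  by transfer simp

lemma const_add: "const (r + s) = (const r + const s :: ('r::{ring, monoid_mult}, 'x) ncfps)"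
proof (rule ncfps_eqI)
  fix w :: "'x list"
  have "(abs_ncpoly (frag_of (MConst (r + s))) :: ('r, 'x) ncpoly) =
      abs_ncpoly (frag_of (MConst r)) + abs_ncpoly (frag_of (MConst s))"
    using coeff_ideal.gen[of r s]
    by (simp add: plus_ncpoly.abs_eq ncpoly.abs_eq_iff algebra_simps)
  then show "coeff (const (r + s)) w = coeff (const r + const s :: ('r, 'x) ncfps) w"
    by (simp add: coeff_const plus_ncfps.rep_eq)
qed

lemma const_mult: "const (r * s) = (const r * const s :: ('r::{ring, monoid_mult}, 'x) ncfps)"
proof (rule ncfps_eqI)
  fix w :: "'x list"
  have "(abs_ncpoly (frag_of (MConst (r * s))) :: ('r, 'x) ncpoly) =
      abs_ncpoly (frag_of (MConst r)) * abs_ncpoly (frag_of (MConst s))"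
    by (simp add: times_ncpoly.abs_eq mult_single plus_monomial_def)
  moreover have "(\<Sum>i\<le>length w. coeff (const r :: ('r, 'x) ncfps) (take i w) * coeff (const s) (drop i w)) =
      (\<Sum>i\<le>length w. if i = 0 \<and> w = [] then coeff (const r) [] * coeff (const s) [] else 0)"
    by (rule sum.cong) (auto simp: coeff_const)
  ultimately show "coeff (const (r * s)) w = coeff (const r * const s :: ('r, 'x) ncfps) w"
    by (auto simp: coeff_const times_ncfps.rep_eq)
qed

lemma const_one: "const 1 = 1"
  by (rule ncfps_eqI) (simp add: coeff_const one_ncfps.rep_eq one_ncpoly_eq)


section \<open>Substitution\<close>

text \<open>
  \<open>ncsubst \<sigma>\<close> replaces every occurrence of every variable \<open>z\<close> in every monomial of a series by the
  series \<open>\<sigma> z\<close>. It is defined first on monomials, then additively on finite \<open>\<int>\<close>-combinations of monomials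
  (where \<open>zmult\<close> is the integer multiple), from there on their quotient, and finally as a formal sum.
\<close>

definition zmult :: "int \<Rightarrow> 'b::ab_group_add \<Rightarrow> 'b" where
  "zmult n x = (\<Sum>i<nat n. x) - (\<Sum>i<nat (- n). x)"

lemma zmult_0 [simp]: "zmult 0 x = 0"
  and zmult_1 [simp]: "zmult 1 x = x"
  by (simp_all add: zmult_def)

lemma zmult_of_nat_diff: "zmult (int a - int b) x = (\<Sum>i<a. x) - (\<Sum>i<b. x)"
proof -
  have add: "(\<Sum>i<m + n. x) = (\<Sum>i<m. x) + (\<Sum>i<n. x)" for m n :: nat
    by (induction n) (simp_all add: add_ac)
  have "nat (int a - int b) = a - b" "nat (- (int a - int b)) = b - a"
    by auto
  moreover have "(\<Sum>i<(a - b) + b. x) = (\<Sum>i<(b - a) + a. x)"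
    by (rule arg_cong[where f = "\<lambda>n. \<Sum>i<n. x"]) auto
  ultimately show ?thesis
    by (simp add: zmult_def add algebra_simps)
qed

lemma zmult_diff: "zmult (m - n) x = zmult m x - zmult n x"
proof -
  have add: "(\<Sum>i<m + n. x) = (\<Sum>i<m. x) + (\<Sum>i<n. x)" for m n :: nat
    by (induction n) (simp_all add: add_ac)
  obtain a b c d where "m = int a - int b" "n = int c - int d"
    by (meson int_diff_cases)
  then have "m - n = int (a + d) - int (b + c)" by simp
  with \<open>m = _\<close> \<open>n = _\<close> show ?thesis
    by (simp only: zmult_of_nat_diff add) (simp add: algebra_simps)
qed

primrec msubst :: "('x \<Rightarrow> ('r, 'y) ncfps) \<Rightarrow> ('r::{ring, monoid_mult}, 'x) monomial \<Rightarrow> ('r, 'y) ncfps" where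
  "msubst \<sigma> (MConst r) = const r"
| "msubst \<sigma> (MTimes r z m) = const r * \<sigma> z * msubst \<sigma> m"

definition fragsubst ::
  "('x \<Rightarrow> ('r, 'y) ncfps) \<Rightarrow> (('r::{ring, monoid_mult}, 'x) monomial \<Rightarrow>\<^sub>0 int) \<Rightarrow> ('r, 'y) ncfps" where
  "fragsubst \<sigma> p = (\<Sum>m \<in> Poly_Mapping.keys p. zmult (Poly_Mapping.lookup p m) (msubst \<sigma> m))"

lemma msubst_mscale: "msubst \<sigma> (mscale r m) = const r * msubst \<sigma> m"
  by (cases m) (simp_all add: const_mult mult.assoc)

lemma msubst_plus: "msubst \<sigma> (m + n) = msubst \<sigma> m * msubst \<sigma> n"
  unfolding plus_monomial_def by (induction m) (simp_all add: msubst_mscale mult.assoc)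

lemma fragsubst_superset:
  assumes "finite S" "Poly_Mapping.keys p \<subseteq> S"
  shows "fragsubst \<sigma> p = (\<Sum>m \<in> S. zmult (Poly_Mapping.lookup p m) (msubst \<sigma> m))"
  unfolding fragsubst_def using assms
  by (intro sum.mono_neutral_left) (auto simp: in_keys_iff)

lemma fragsubst_diff: "fragsubst \<sigma> (p - q) = fragsubst \<sigma> p - fragsubst \<sigma> q"
proof -
  let ?S = "Poly_Mapping.keys p \<union> Poly_Mapping.keys q"
  have "Poly_Mapping.keys (p - q) \<subseteq> ?S" by (rule keys_diff)
  then show ?thesis
    by (simp add: fragsubst_superset[of ?S] lookup_minus zmult_diff sum_subtractf)
qed

lemma fragsubst_zero: "fragsubst \<sigma> 0 = 0"
  by (simp add: fragsubst_def)

lemma fragsubst_frag_of: "fragsubst \<sigma> (frag_of m) = msubst \<sigma> m"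
  by (simp add: fragsubst_def)

lemma fragsubst_mult: "fragsubst \<sigma> (p * q) = fragsubst \<sigma> p * fragsubst \<sigma> q"
proof -
  have *: "fragsubst \<sigma> (frag_of m * q) = fragsubst \<sigma> (frag_of m) * fragsubst \<sigma> q" for m
    using subset_UNIV
  proof (induction q rule: frag_induction)
    case (one n)
    have "frag_of m * frag_of n = (frag_of (m + n) :: _ \<Rightarrow>\<^sub>0 int)"
      by (simp add: mult_single)
    then show ?case by (simp add: fragsubst_frag_of msubst_plus)
  qed (simp_all add: fragsubst_zero fragsubst_diff right_diff_distrib)
  show ?thesis
    using subset_UNIV
    by (induction p rule: frag_induction)
      (simp_all add: * fragsubst_zero fragsubst_diff left_diff_distrib)
qed

lemma fragsubst_coeff_ideal: "p \<in> coeff_ideal \<Longrightarrow> fragsubst \<sigma> p = 0"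
  by (induction rule: coeff_ideal.induct)
    (simp_all add: fragsubst_zero fragsubst_diff fragsubst_mult fragsubst_frag_of const_add)

lift_definition psubst ::
  "('x \<Rightarrow> ('r, 'y) ncfps) \<Rightarrow> ('r::{ring, monoid_mult}, 'x) ncpoly \<Rightarrow> ('r, 'y) ncfps" is fragsubst
  by (metis fragsubst_coeff_ideal fragsubst_diff eq_iff_diff_eq_0)

definition ncsubst ::
  "('x \<Rightarrow> ('r, 'y) ncfps) \<Rightarrow> ('r::{ring, monoid_mult}, 'x) ncfps \<Rightarrow> ('r, 'y) ncfps" where
  "ncsubst \<sigma> f = formal_sum (\<lambda>w. psubst \<sigma> (coeff f w)) UNIV"


section \<open>Series in \<open>X\<close> and \<open>Y\<^sub>\<alpha>\<close>\<close>

datatype 'a indet = X_var | Y_var 'a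

abbreviation fX :: "('r::{ring, monoid_mult}, 'a indet) ncfps" where
  "fX \<equiv> var X_var"

abbreviation fY :: "'a \<Rightarrow> ('r::{ring, monoid_mult}, 'a indet) ncfps" where
  "fY \<alpha> \<equiv> var (Y_var \<alpha>)"

text \<open>
  The defining sum is locally finite if every monomial of \<open>h\<close> has \<open>X\<close>-degree at least 1: a word
  \<open>w\<close> then only receives contributions from words \<open>u\<close> with \<open>length u \<le> length w\<close> all of whose
  variables \<open>Y\<^sub>\<alpha>\<close> occur in \<open>w\<close>.
\<close>

definition X_compose (infixl \<open>\<circ>\<^sub>X\<close> 55) where
  "f \<circ>\<^sub>X h = ncsubst (\<lambda>z. case z of X_var \<Rightarrow> h | Y_var \<alpha> \<Rightarrow> fY \<alpha>) f"

text \<open>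
  Series in \<open>X\<close> and the \<open>Y\<^sub>\<beta>\<close> with \<open>\<beta> \<in> A\<close> all of whose monomials have degree at least 1 in \<open>X\<close>
  and involve at least one \<open>Y\<^sub>\<beta>\<close>.
\<close>

definition XY_series :: "'a set \<Rightarrow> ('r::{ring, monoid_mult}, 'a indet) ncfps set" where
  "XY_series A = {f. \<forall>w. coeff f w \<noteq> 0 \<longrightarrow>
     set w \<subseteq> insert X_var (Y_var ` A) \<and> X_var \<in> set w \<and> (\<exists>\<beta>\<in>A. Y_var \<beta> \<in> set w)}"

text \<open>
  For infinite \<open>A\<close> the sum is locally finite whenever all monomials of \<open>V \<beta>\<close> have
  \<open>Y\<^sub>\<beta>\<close> as their first variable, as the equations below enforce.
\<close>

definition mat_vec ::
  "'a set \<Rightarrow> ('a \<Rightarrow> 'a \<Rightarrow> 'r) \<Rightarrow> ('a \<Rightarrow> ('r::{ring, monoid_mult}, 'a indet) ncfps) \<Rightarrow> 'a \<Rightarrow> ('r, 'a indet) ncfps" where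
  "mat_vec A M V \<alpha> = formal_sum (\<lambda>\<beta>. const (M \<alpha> \<beta>) * V \<beta>) A"

text \<open>
  \<open>P k\<close> is the part of \<open>A\<close> with index \<open>k \<in> K\<close>, and \<open>M k i\<close> for \<open>1 \<le> i \<le> k\<close> is the \<open>i\<close>-th
  of its matrices, whose entries are used only at \<open>P k \<times> A\<close>.
\<close>

definition is_g_family ::
  "nat set \<Rightarrow> (nat \<Rightarrow> 'a set) \<Rightarrow> 'a set \<Rightarrow> (nat \<Rightarrow> nat \<Rightarrow> 'a \<Rightarrow> 'a \<Rightarrow> 'r) \<Rightarrow>
    ('a \<Rightarrow> ('r::{ring, monoid_mult}, 'a indet) ncfps) \<Rightarrow> bool" where
  "is_g_family K P A M V \<longleftrightarrow> V \<in> A \<rightarrow>\<^sub>E XY_series A \<and>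
     (\<forall>k\<in>K. \<forall>\<alpha>\<in>P k. V \<alpha> = fY \<alpha> * (\<Prod>i\<leftarrow>[1..<Suc k]. fX - mat_vec A (M k i) V \<alpha>))"

definition is_g_tilde_family ::
  "nat set \<Rightarrow> (nat \<Rightarrow> 'a set) \<Rightarrow> 'a set \<Rightarrow> (nat \<Rightarrow> nat \<Rightarrow> 'a \<Rightarrow> 'a \<Rightarrow> 'r) \<Rightarrow>
    ('a \<Rightarrow> ('r::{ring, monoid_mult}, 'a indet) ncfps) \<Rightarrow> bool" where
  "is_g_tilde_family K P A M' V \<longleftrightarrow> V \<in> A \<rightarrow>\<^sub>E XY_series A \<and>
     (\<forall>k\<in>K. \<forall>\<alpha>\<in>P k. V \<alpha> = fY \<alpha> * (\<Prod>i\<leftarrow>[1..<Suc k]. - fX + mat_vec A (M' k i) V \<alpha>))"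

end

theory Submission
  imports Defs
begin

text \<open>
  Write \<open>g'\<close> for the series with a tilde. Both families solve a system \<open>V\<^sub>\<alpha> = Y\<^sub>\<alpha> (c - (N\<^sub>1V)\<^sub>\<alpha>) \<dots> (c - (N\<^sub>kV)\<^sub>\<alpha>)\<close>: the family \<open>g\<^sub>\<alpha>\<close> with \<open>c = X\<close>
  and \<open>N = M\<close>, the family \<open>g'\<^sub>\<alpha>\<close> with \<open>c = - X\<close> and \<open>N = M - J\<close>. Since the leading \<open>Y\<^sub>\<alpha>\<close> makes the
  right-hand side contracting with respect to word length, such a system has a unique solution
  for every series \<open>c\<close>. Substituting \<open>X\<close> by \<open>g'\<close> turns \<open>(g\<^sub>\<alpha>)\<close> into a solution for \<open>c = g'\<close>, \<open>N = M\<close>.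
  As \<open>g' - M V = - X + (J - M) V\<close> for \<open>V = (g'\<^sub>\<alpha>)\<close>, the family \<open>(g'\<^sub>\<alpha>)\<close> solves the same system.
  Hence \<open>g\<^sub>\<alpha> \<circ> g' = g'\<^sub>\<alpha>\<close>, and summing over \<open>\<alpha>\<close> gives \<open>g \<circ> g' = X\<close>; the other composition is
  symmetric.
\<close>

section \<open>Supports and coefficients\<close>

definition support :: "('r::{ring, monoid_mult}, 'x) ncfps \<Rightarrow> 'x list set" where
  "support f = {w. coeff f w \<noteq> 0}"

lemma coeff_zero [simp]: "coeff 0 w = 0"
  by (simp add: zero_ncfps.rep_eq)

lemma coeff_add [simp]: "coeff (f + g) w = coeff f w + coeff g w"
  by (simp add: plus_ncfps.rep_eq)

lemma coeff_diff [simp]: "coeff (f - g) w = coeff f w - coeff g w"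
  by (simp add: minus_ncfps.rep_eq)

lemma coeff_uminus [simp]: "coeff (- f) w = - coeff f w"
  by (simp add: uminus_ncfps.rep_eq)

lemma coeff_sum: "coeff (sum F I) w = (\<Sum>i\<in>I. coeff (F i) w)"
  by (induction I rule: infinite_finite_induct) auto

lemma coeff_mult: "coeff (f * g) w = (\<Sum>i\<le>length w. coeff f (take i w) * coeff g (drop i w))"
  by (simp add: times_ncfps.rep_eq)

lemma coeff_var: "coeff (var z) w = (if w = [z] then abs_ncpoly (frag_of (MTimes 1 z (MConst 1))) else 0)"
  by (simp add: var.rep_eq)

lemma coeff_formal_sum: "coeff (formal_sum F I) w = (\<Sum>i \<in> {i \<in> I. coeff (F i) w \<noteq> 0}. coeff (F i) w)"
  by (simp add: formal_sum.rep_eq)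

text \<open>The index set inside \<open>formal_sum\<close> varies with the word and the family; one
  common finite set \<open>J\<close> makes such sums comparable.\<close>

lemma coeff_formal_sum_superset:
  assumes "finite J" "J \<subseteq> I" "\<And>i. i \<in> I - J \<Longrightarrow> coeff (F i) w = 0"
  shows "coeff (formal_sum F I) w = (\<Sum>i\<in>J. coeff (F i) w)"
  unfolding coeff_formal_sum by (rule sum.mono_neutral_left) (use assms in auto)

lemma support_uminus [simp]: "support (- f) = support f"
  by (simp add: support_def)

lemma support_add: "support (f + g) \<subseteq> support f \<union> support g"
  by (auto simp: support_def)

lemma support_diff: "support (f - g) \<subseteq> support f \<union> support g"
  by (auto simp: support_def)

lemma support_const: "support (const r) \<subseteq> {[]}"
  by (auto simp: support_def coeff_const)

lemma support_var: "support (var z) \<subseteq> {[z]}"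
  by (auto simp: support_def coeff_var)

lemma support_formal_sum: "support (formal_sum F I) \<subseteq> (\<Union>i\<in>I. support (F i))"
proof
  fix w assume "w \<in> support (formal_sum F I)"
  then have "coeff (formal_sum F I) w \<noteq> 0" by (simp add: support_def)
  then obtain i where "i \<in> I" "coeff (F i) w \<noteq> 0"
    unfolding coeff_formal_sum by (rule sum.not_neutral_contains_not_neutral) auto
  then show "w \<in> (\<Union>i\<in>I. support (F i))" by (auto simp: support_def)
qed

lemma support_multE:
  assumes "w \<in> support (f * g)"
  obtains u v where "w = u @ v" "u \<in> support f" "v \<in> support g"
proof -
  from assms have "coeff (f * g) w \<noteq> 0" by (simp add: support_def)
  then obtain i where "coeff f (take i w) * coeff g (drop i w) \<noteq> 0"
    unfolding coeff_mult by (rule sum.not_neutral_contains_not_neutral)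
  then show thesis
    by (intro that[of "take i w" "drop i w"]) (auto simp: support_def)
qed

lemma support_const_mult: "support (const r * f) \<subseteq> support f"
proof
  fix w assume "w \<in> support (const r * f)"
  then obtain u v where "w = u @ v" "u \<in> support (const r)" "v \<in> support f"
    by (rule support_multE)
  with support_const[of r] show "w \<in> support f" by auto
qed

lemma const_uminus: "const (- r) = - const r"
proof -
  have "const 0 + const 0 = (const 0 + 0 :: ('a, 'b) ncfps)"
    by (simp flip: const_add)
  then have "const 0 = (0 :: ('a, 'b) ncfps)"
    by (simp only: add_left_cancel)
  then have "const r + const (- r) = (0 :: ('a, 'b) ncfps)"
    by (simp flip: const_add)
  then show ?thesis by (simp add: eq_neg_iff_add_eq_0 add.commute)
qed

lemma formal_sum_cong: "(\<And>i. i \<in> I \<Longrightarrow> F i = G i) \<Longrightarrow> formal_sum F I = formal_sum G I"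
  by (rule ncfps_eqI) (auto simp: coeff_formal_sum intro!: sum.cong)

lemma formal_sum_uminus: "formal_sum (\<lambda>i. - F i) I = - formal_sum F I"
  by (rule ncfps_eqI) (simp add: coeff_formal_sum sum_negf)

section \<open>Locally finite families\<close>

definition locally_finite :: "('i \<Rightarrow> ('r::{ring, monoid_mult}, 'x) ncfps) \<Rightarrow> 'i set \<Rightarrow> bool" where
  "locally_finite F I \<longleftrightarrow> (\<forall>w. finite {i \<in> I. w \<in> support (F i)})"

lemma locally_finite_const_mult:
  assumes "locally_finite F I"
  shows "locally_finite (\<lambda>i. const (r i) * F i) I"
  unfolding locally_finite_def
proof
  fix w
  show "finite {i \<in> I. w \<in> support (const (r i) * F i)}"
    by (rule finite_subset[of _ "{i \<in> I. w \<in> support (F i)}"])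
      (use assms support_const_mult in \<open>auto simp: locally_finite_def\<close>)
qed

lemma formal_sum_add:
  assumes "locally_finite F I" "locally_finite G I"
  shows "formal_sum (\<lambda>i. F i + G i) I = formal_sum F I + formal_sum G I"
proof (rule ncfps_eqI)
  fix w
  \<comment> \<open>Outside this set \<open>F i\<close>, \<open>G i\<close> and their sum all vanish
    at \<open>w\<close>, so the three formal sums become finite sums over it.\<close>
  let ?J = "{i \<in> I. w \<in> support (F i)} \<union> {i \<in> I. w \<in> support (G i)}"
  have J: "finite ?J" "?J \<subseteq> I"
    using assms by (auto simp: locally_finite_def)
  have "coeff (formal_sum H I) w = (\<Sum>i\<in>?J. coeff (H i) w)"
    if "\<And>i. support (H i) \<subseteq> support (F i) \<union> support (G i)" for H
    by (rule coeff_formal_sum_superset[OF J]) (use that in \<open>auto simp: support_def\<close>)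
  from this[of "\<lambda>i. F i + G i"] this[of F] this[of G]
  show "coeff (formal_sum (\<lambda>i. F i + G i) I) w = coeff (formal_sum F I + formal_sum G I) w"
    by (simp add: support_add sum.distrib)
qed

section \<open>Substitution as a ring homomorphism\<close>

lemma psubst_abs: "psubst \<sigma> (abs_ncpoly p) = fragsubst \<sigma> p"
  by (simp add: psubst.abs_eq)

lemma psubst_diff: "psubst \<sigma> (p - q) = psubst \<sigma> p - psubst \<sigma> q"
  by transfer (simp add: fragsubst_diff)

lemma psubst_zero [simp]: "psubst \<sigma> 0 = 0"
  by transfer (simp add: fragsubst_zero)

lemma psubst_uminus: "psubst \<sigma> (- p) = - psubst \<sigma> p"
  using psubst_diff[of \<sigma> 0 p] by simp

lemma psubst_add: "psubst \<sigma> (p + q) = psubst \<sigma> p + psubst \<sigma> q"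
  using psubst_diff[of \<sigma> p "- q"] by (simp add: psubst_uminus)

lemma psubst_mult: "psubst \<sigma> (p * q) = psubst \<sigma> p * psubst \<sigma> q"
  by transfer (simp add: fragsubst_mult)

lemma psubst_sum: "psubst \<sigma> (sum F I) = (\<Sum>i\<in>I. psubst \<sigma> (F i))"
  by (induction I rule: infinite_finite_induct) (auto simp: psubst_add)

text \<open>Enough for \<^const>\<open>ncsubst\<close> to be a locally finite sum: a substituted word is at least as long
  as the original one, and all but finitely many variables leave a trace in it.\<close>

definition admissible :: "'x set \<Rightarrow> ('x \<Rightarrow> ('r::{ring, monoid_mult}, 'x) ncfps) \<Rightarrow> bool" where
  "admissible E \<sigma> \<longleftrightarrow> finite E \<and> (\<forall>z. \<forall>w \<in> support (\<sigma> z). w \<noteq> [] \<and> z \<in> E \<union> set w)"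

text \<open>A finite bound, for finite \<open>E\<close>, on the words that can contribute to
  \<open>w\<close> under an admissible substitution.\<close>

definition source_words :: "'x set \<Rightarrow> 'x list \<Rightarrow> 'x list set" where
  "source_words E w = {u. set u \<subseteq> E \<union> set w \<and> length u \<le> length w}"

lemma finite_source_words: "finite E \<Longrightarrow> finite (source_words E w)"
  unfolding source_words_def by (rule finite_lists_length_le) auto

text \<open>Each factor \<open>const r * \<sigma> z\<close> produces a nonempty piece of
  \<open>w\<close>. It accounts for one letter of the length and contains \<open>z\<close> unless
  \<open>z\<close> lies in \<open>E\<close>.\<close>

lemma mword_source_words:
  assumes "admissible E \<sigma>" "w \<in> support (msubst \<sigma> m)"
  shows "mword m \<in> source_words E w"
  using assms(2)
proof (induction m arbitrary: w)
  case (MConst r)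
  then show ?case by (simp add: source_words_def)
next
  case (MTimes r z m)
  from MTimes.prems obtain u v where w: "w = u @ v"
    and u: "u \<in> support (const r * \<sigma> z)" and v: "v \<in> support (msubst \<sigma> m)"
    by (auto elim: support_multE)
  from u support_const_mult have "u \<in> support (\<sigma> z)" by blast
  with assms(1) have "u \<noteq> []" "z \<in> E \<union> set u"
    by (auto simp: admissible_def)
  moreover from \<open>u \<noteq> []\<close> have "Suc 0 \<le> length u" by (cases u) simp_all
  ultimately show ?case
    using MTimes.IH[OF v] by (auto simp: source_words_def w simp del: Suc_le_eq)
qed

lemma zmult_zero_right: "zmult n 0 = 0"
  by (simp add: zmult_def)

lemma coeff_zmult: "coeff (zmult n f) w = zmult n (coeff f w)"
  by (simp add: zmult_def coeff_sum)

lemma coeff_psubst_eq_0: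
  assumes "admissible E \<sigma>" "p \<in> word_part u" "u \<notin> source_words E w"
  shows "coeff (psubst \<sigma> p) w = 0"
proof -
  from assms(2) obtain q where p: "p = abs_ncpoly q"
    and q: "\<And>m. m \<in> Poly_Mapping.keys q \<Longrightarrow> mword m = u"
    by (auto simp: word_part_def)
  have "coeff (msubst \<sigma> m) w = 0" if "m \<in> Poly_Mapping.keys q" for m
    using mword_source_words[OF assms(1), of w m] assms(3) q[OF that]
    by (auto simp: support_def)
  then show ?thesis
    by (simp add: p psubst_abs fragsubst_def coeff_sum coeff_zmult zmult_zero_right)
qed

text \<open>An arbitrary finite superset \<open>S\<close> is allowed so that the product rule can
  use one index set for all prefixes and suffixes of \<open>w\<close>.\<close>

lemma coeff_ncsubst:
  assumes "admissible E \<sigma>" "finite S" "source_words E w \<subseteq> S"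
  shows "coeff (ncsubst \<sigma> f) w = (\<Sum>u\<in>S. coeff (psubst \<sigma> (coeff f u)) w)"
  unfolding ncsubst_def
  by (rule coeff_formal_sum_superset)
    (use assms coeff_psubst_eq_0[OF assms(1) coeff_word_part] in auto)

lemma admissible_finite: "admissible E \<sigma> \<Longrightarrow> finite E"
  by (simp add: admissible_def)

section \<open>Compatibility of substitution with sums and products\<close>

lemma ncsubst_diff:
  assumes "admissible E \<sigma>"
  shows "ncsubst \<sigma> (f - g) = ncsubst \<sigma> f - ncsubst \<sigma> g"
  by (rule ncfps_eqI)
    (simp add: coeff_ncsubst[OF assms finite_source_words[OF admissible_finite[OF assms]] order.refl]
      psubst_diff sum_subtractf)

lemma ncsubst_uminus:
  assumes "admissible E \<sigma>"
  shows "ncsubst \<sigma> (- f) = - ncsubst \<sigma> f"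
  using ncsubst_diff[OF assms, of f f] ncsubst_diff[OF assms, of 0 f] by simp

text \<open>Finitely many source words matter for \<open>w\<close>, and each occurs in finitely many
  members of the family, so exchanging two finite sums suffices.\<close>

lemma ncsubst_formal_sum:
  assumes adm: "admissible E \<sigma>" and lf: "locally_finite F I"
  shows "ncsubst \<sigma> (formal_sum F I) = formal_sum (\<lambda>i. ncsubst \<sigma> (F i)) I"
proof (rule ncfps_eqI)
  fix w
  let ?S = "source_words E w"
  define J where "J = (\<Union>u\<in>?S. {i \<in> I. u \<in> support (F i)})"
  have S: "finite ?S" by (rule finite_source_words[OF admissible_finite[OF adm]])
  have J: "finite J" "J \<subseteq> I"
    using S lf by (auto simp: J_def locally_finite_def)
  have outside: "coeff (F i) u = 0" if "i \<in> I - J" "u \<in> ?S" for i u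
    using that by (auto simp: J_def support_def)
  note subst = coeff_ncsubst[OF adm S order.refl]
  have "coeff (ncsubst \<sigma> (formal_sum F I)) w = (\<Sum>u\<in>?S. coeff (psubst \<sigma> (\<Sum>i\<in>J. coeff (F i) u)) w)"
    unfolding subst
    by (intro sum.cong refl arg_cong[where f = "\<lambda>p. coeff (psubst \<sigma> p) w"]
        coeff_formal_sum_superset J outside)
  also have "\<dots> = (\<Sum>i\<in>J. coeff (ncsubst \<sigma> (F i)) w)"
    unfolding subst psubst_sum coeff_sum by (rule sum.swap)
  also have "\<dots> = coeff (formal_sum (\<lambda>i. ncsubst \<sigma> (F i)) I) w"
    by (rule coeff_formal_sum_superset[symmetric, OF J]) (simp add: subst outside)
  finally show "coeff (ncsubst \<sigma> (formal_sum F I)) w = coeff (formal_sum (\<lambda>i. ncsubst \<sigma> (F i)) I) w" .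
qed

text \<open>Two kinds of cuts are exchanged: a source word into \<open>a\<close> and
  \<open>b\<close>, and \<open>w\<close> into a prefix and a suffix. The left side runs over the
  pairs with \<open>a @ b\<close> in \<open>?S\<close>, the right side over
  \<open>?S \<times> ?S\<close>; the surplus pairs contribute 0.\<close>

lemma ncsubst_mult:
  assumes adm: "admissible E \<sigma>"
  shows "ncsubst \<sigma> (f * g) = ncsubst \<sigma> f * ncsubst \<sigma> g"
proof (rule ncfps_eqI)
  fix w
  let ?S = "source_words E w"
  let ?c = "\<lambda>f u v. coeff (psubst \<sigma> (coeff f u)) v"
  let ?T = "\<lambda>a b. \<Sum>j\<le>length w. ?c f a (take j w) * ?c g b (drop j w)"
  have S: "finite ?S" by (rule finite_source_words[OF admissible_finite[OF adm]])
  have sub: "source_words E (take j w) \<subseteq> ?S" "source_words E (drop j w) \<subseteq> ?S" for j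
    by (auto simp: source_words_def dest: in_set_takeD in_set_dropD)
  have "coeff (ncsubst \<sigma> (f * g)) w =
      (\<Sum>u\<in>?S. \<Sum>i\<le>length u. ?T (take i u) (drop i u))"
    unfolding coeff_ncsubst[OF adm S order.refl] coeff_mult[of f] psubst_sum psubst_mult coeff_sum
    by (simp add: coeff_mult)
  also have "\<dots> = (\<Sum>(u, i)\<in>(SIGMA u:?S. {..length u}). ?T (take i u) (drop i u))"
    using S by (intro sum.Sigma) auto
  also have "\<dots> = (\<Sum>(a, b)\<in>{(a, b). a @ b \<in> ?S}. ?T a b)"
    by (rule sum.reindex_bij_witness[where i = "\<lambda>(a, b). (a @ b, length a)"
          and j = "\<lambda>(u, i). (take i u, drop i u)"]) auto
  also have "\<dots> = (\<Sum>(a, b)\<in>?S \<times> ?S. ?T a b)"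
  proof (rule sum.mono_neutral_left)
    show "finite (?S \<times> ?S)" using S by simp
    show "{(a, b). a @ b \<in> ?S} \<subseteq> ?S \<times> ?S" by (auto simp: source_words_def)
    show "\<forall>p \<in> ?S \<times> ?S - {(a, b). a @ b \<in> ?S}. (case p of (a, b) \<Rightarrow> ?T a b) = 0"
    proof (rule ballI, split prod.split, intro allI impI)
      fix p a b assume "p \<in> ?S \<times> ?S - {(a, b). a @ b \<in> ?S}" "p = (a, b)"
      then have ab: "a \<in> ?S" "b \<in> ?S" "a @ b \<notin> ?S" by auto
      show "?T a b = 0"
      proof (intro sum.neutral ballI)
        fix j assume "j \<in> {..length w}"
        \<comment> \<open>If \<open>a\<close> came from the prefix and \<open>b\<close> from the
          suffix, then \<open>a @ b\<close> would be a source word of \<open>w\<close>.\<close>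
        with ab have "a \<notin> source_words E (take j w) \<or> b \<notin> source_words E (drop j w)"
          by (auto simp: source_words_def)
        then show "?c f a (take j w) * ?c g b (drop j w) = 0"
          using coeff_psubst_eq_0[OF adm coeff_word_part] by auto
      qed
    qed
  qed
  also have "\<dots> = (\<Sum>j\<le>length w. \<Sum>a\<in>?S. \<Sum>b\<in>?S. ?c f a (take j w) * ?c g b (drop j w))"
    unfolding sum.cartesian_product[symmetric]
    by (simp add: sum.swap[of _ "{..length w}"])
  also have "\<dots> = coeff (ncsubst \<sigma> f * ncsubst \<sigma> g) w"
    unfolding coeff_mult[of "ncsubst \<sigma> f"]
    by (simp add: coeff_ncsubst[OF adm S sub(1)] coeff_ncsubst[OF adm S sub(2)] sum_product)
  finally show "coeff (ncsubst \<sigma> (f * g)) w = coeff (ncsubst \<sigma> f * ncsubst \<sigma> g) w" .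
qed

lemma ncsubst_single_word:
  assumes "support f \<subseteq> {u}"
  shows "ncsubst \<sigma> f = psubst \<sigma> (coeff f u)"
proof (rule ncfps_eqI)
  fix w
  have "coeff f v = 0" if "v \<noteq> u" for v
    using assms that by (auto simp: support_def)
  then show "coeff (ncsubst \<sigma> f) w = coeff (psubst \<sigma> (coeff f u)) w"
    unfolding ncsubst_def by (subst coeff_formal_sum_superset[of "{u}"]) auto
qed

lemma ncsubst_const [simp]: "ncsubst \<sigma> (const r) = const r"
  by (simp add: ncsubst_single_word[OF support_const] coeff_const psubst_abs fragsubst_frag_of)

lemma ncsubst_var [simp]: "ncsubst \<sigma> (var z) = \<sigma> z"
  by (simp add: ncsubst_single_word[OF support_var] coeff_var psubst_abs fragsubst_frag_of const_one)

lemma ncsubst_prod_list: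
  assumes "admissible E \<sigma>"
  shows "ncsubst \<sigma> (\<Prod>i\<leftarrow>xs. F i) = (\<Prod>i\<leftarrow>xs. ncsubst \<sigma> (F i))"
proof (induction xs)
  case Nil
  then show ?case using ncsubst_const[of \<sigma> 1] by (simp add: const_one)
next
  case (Cons x xs)
  then show ?case by (simp add: ncsubst_mult[OF assms])
qed

section \<open>Agreement of series on short words\<close>

text \<open>Closeness in the ultrametric given by word length. The strict bound makes level 0
  vacuous, which starts the inductions.\<close>

definition eq_upto :: "nat \<Rightarrow> ('r::{ring, monoid_mult}, 'x) ncfps \<Rightarrow> ('r, 'x) ncfps \<Rightarrow> bool" where
  "eq_upto n f g \<longleftrightarrow> (\<forall>w. length w < n \<longrightarrow> coeff f w = coeff g w)"

lemma eq_upto_refl [simp]: "eq_upto n f f"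
  by (simp add: eq_upto_def)

lemma eq_upto_0 [simp]: "eq_upto 0 f g"
  by (simp add: eq_upto_def)

lemma eq_upto_trans: "eq_upto n f g \<Longrightarrow> eq_upto n g h \<Longrightarrow> eq_upto n f h"
  by (simp add: eq_upto_def)

lemma eq_upto_sym: "eq_upto n f g \<Longrightarrow> eq_upto n g f"
  by (simp add: eq_upto_def)

lemma eq_upto_mono: "eq_upto n f g \<Longrightarrow> m \<le> n \<Longrightarrow> eq_upto m f g"
  by (simp add: eq_upto_def)

lemma eq_upto_all_eq: "(\<And>n. eq_upto n f g) \<Longrightarrow> f = g"
  by (rule ncfps_eqI) (auto simp: eq_upto_def)

lemma eq_upto_diff: "eq_upto n f f' \<Longrightarrow> eq_upto n g g' \<Longrightarrow> eq_upto n (f - g) (f' - g')"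
  by (simp add: eq_upto_def)

lemma eq_upto_mult: "eq_upto n f f' \<Longrightarrow> eq_upto n g g' \<Longrightarrow> eq_upto n (f * g) (f' * g')"
  by (auto simp: eq_upto_def coeff_mult intro!: sum.cong)

lemma eq_upto_formal_sum:
  "(\<And>i. i \<in> I \<Longrightarrow> eq_upto n (F i) (G i)) \<Longrightarrow> eq_upto n (formal_sum F I) (formal_sum G I)"
  by (auto simp: eq_upto_def coeff_formal_sum intro!: sum.cong)

text \<open>The variable uses up one letter: the empty prefix contributes 0, and every other cut
  evaluates \<open>f\<close> and \<open>g\<close> at a shorter word.\<close>

lemma eq_upto_var_mult:
  fixes z :: 'x
  assumes "eq_upto n f g"
  shows "eq_upto (Suc n) (var z * f) (var z * g)"
  unfolding eq_upto_def
proof (intro allI impI)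
  fix w :: "'x list" assume w: "length w < Suc n"
  have "coeff (var z) (take i w) * coeff f (drop i w) = coeff (var z) (take i w) * coeff g (drop i w)"
    if "i \<le> length w" for i
  proof (cases "i = 0")
    case False
    with that w have "length (drop i w) < n" by auto
    with assms show ?thesis by (simp add: eq_upto_def)
  qed (simp add: coeff_var)
  then show "coeff (var z * f) w = coeff (var z * g) w"
    by (simp add: coeff_mult)
qed

lemma eq_upto_prod_list:
  "(\<And>i. i \<in> set xs \<Longrightarrow> eq_upto n (F i) (G i)) \<Longrightarrow> eq_upto n (\<Prod>i\<leftarrow>xs. F i) (\<Prod>i\<leftarrow>xs. G i)"
  by (induction xs) (auto intro: eq_upto_mult)

text \<open>Banach's fixed-point theorem for this ultrametric, iterating from 0. The second
  conclusion carries coefficientwise properties of the iterates over to the limit.\<close>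

lemma contraction_fixpoint:
  fixes \<Phi> :: "('i \<Rightarrow> ('r::{ring, monoid_mult}, 'x) ncfps) \<Rightarrow> 'i \<Rightarrow> ('r, 'x) ncfps"
  assumes contr: "\<And>n U V. (\<And>i. eq_upto n (U i) (V i)) \<Longrightarrow> (\<And>i. eq_upto (Suc n) (\<Phi> U i) (\<Phi> V i))"
  obtains V where "\<Phi> V = V" "\<And>n i. eq_upto n (V i) ((\<Phi> ^^ n) (\<lambda>_. 0) i)"
proof -
  let ?U = "\<lambda>n. (\<Phi> ^^ n) (\<lambda>_. 0)"
  have step: "eq_upto n (?U n i) (?U (Suc n) i)" for n i
  proof (induction n arbitrary: i)
    case (Suc n)
    show ?case using contr[OF Suc.IH] by simp
  qed simp
  have later: "eq_upto n (?U n i) (?U m i)" if "n \<le> m" for n m i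
    using that
  proof (induction rule: dec_induct)
    case (step m)
    with \<open>\<And>n i. eq_upto n (?U n i) (?U (Suc n) i)\<close>[of m i] show ?case
      by (meson eq_upto_mono eq_upto_trans)
  qed simp
  \<comment> \<open>The coefficient at a word of length \<open>l\<close> is stable from iterate
    \<open>l + 1\<close> on, since level \<open>n\<close> controls only words shorter than
    \<open>n\<close>.\<close>
  define V where "V i = Abs_ncfps (\<lambda>w. coeff (?U (Suc (length w)) i) w)" for i
  have coeff_V: "coeff (V i) w = coeff (?U (Suc (length w)) i) w" for i w
    unfolding V_def by (subst Abs_ncfps_inverse) (auto simp: coeff_word_part)
  have V: "eq_upto n (V i) (?U n i)" for n i
    unfolding eq_upto_def coeff_V
  proof (intro allI impI)
    fix w :: "'x list" assume "length w < n"
    then have "eq_upto (Suc (length w)) (?U (Suc (length w)) i) (?U n i)"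
      by (intro later) simp
    then show "coeff (?U (Suc (length w)) i) w = coeff (?U n i) w"
      unfolding eq_upto_def by blast
  qed
  have "\<Phi> V i = V i" for i
  proof (rule eq_upto_all_eq)
    fix n
    have "eq_upto (Suc n) (\<Phi> V i) (?U (Suc n) i)"
      using contr[OF V] by simp
    then have "eq_upto (Suc n) (\<Phi> V i) (V i)"
      using V eq_upto_sym eq_upto_trans by blast
    then show "eq_upto n (\<Phi> V i) (V i)"
      by (rule eq_upto_mono) simp
  qed
  with V that show thesis by blast
qed

section \<open>The systems of equations\<close>

text \<open>Leaving \<open>c\<close> free keeps the shape of the system under substitution for
  \<open>X\<close>.\<close>

definition solves_system ::
  "nat set \<Rightarrow> (nat \<Rightarrow> 'a set) \<Rightarrow> 'a set \<Rightarrow> ('r::{ring, monoid_mult}, 'a indet) ncfps \<Rightarrow>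
    (nat \<Rightarrow> nat \<Rightarrow> 'a \<Rightarrow> 'a \<Rightarrow> 'r) \<Rightarrow> ('a \<Rightarrow> ('r, 'a indet) ncfps) \<Rightarrow> bool" where
  "solves_system K P A c N V \<longleftrightarrow>
    (\<forall>k\<in>K. \<forall>\<alpha>\<in>P k. V \<alpha> = fY \<alpha> * (\<Prod>i\<leftarrow>[1..<Suc k]. c - mat_vec A (N k i) V \<alpha>))"

lemma mat_vec_cong: "(\<And>\<beta>. \<beta> \<in> A \<Longrightarrow> U \<beta> = V \<beta>) \<Longrightarrow> mat_vec A M U \<alpha> = mat_vec A M V \<alpha>"
  unfolding mat_vec_def by (rule formal_sum_cong) simp

lemma eq_upto_mat_vec:
  "(\<And>\<beta>. \<beta> \<in> A \<Longrightarrow> eq_upto n (U \<beta>) (V \<beta>)) \<Longrightarrow> eq_upto n (mat_vec A M U \<alpha>) (mat_vec A M V \<alpha>)"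
  unfolding mat_vec_def by (intro eq_upto_formal_sum eq_upto_mult) auto

lemma support_mat_vec: "support (mat_vec A M V \<alpha>) \<subseteq> (\<Union>\<beta>\<in>A. support (V \<beta>))"
  unfolding mat_vec_def
  by (rule order.trans[OF support_formal_sum]) (intro UN_mono order.refl support_const_mult)

lemma mat_vec_uminus: "mat_vec A (\<lambda>\<alpha> \<beta>. - M \<alpha> \<beta>) V \<alpha> = - mat_vec A M V \<alpha>"
  unfolding mat_vec_def by (simp add: const_uminus flip: formal_sum_uminus)

text \<open>The all-ones matrix sends \<open>V\<close> to its formal sum in every row, and local
  finiteness lets this summand be split off.\<close>

lemma mat_vec_plus_ones:
  assumes "locally_finite V A"
  shows "mat_vec A (\<lambda>\<alpha> \<beta>. M \<alpha> \<beta> + 1) V \<alpha> = mat_vec A M V \<alpha> + formal_sum V A"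
  unfolding mat_vec_def
  by (simp add: const_add const_one distrib_right
      formal_sum_add[OF locally_finite_const_mult[OF assms] assms])

lemma mat_vec_ncsubst:
  assumes "admissible E \<sigma>" "locally_finite V A"
  shows "ncsubst \<sigma> (mat_vec A M V \<alpha>) = mat_vec A M (\<lambda>\<beta>. ncsubst \<sigma> (V \<beta>)) \<alpha>"
  unfolding mat_vec_def
  by (simp add: ncsubst_formal_sum[OF assms(1) locally_finite_const_mult[OF assms(2)]]
      ncsubst_mult[OF assms(1)])

lemma eq_upto_system:
  assumes "\<And>\<beta>. \<beta> \<in> A \<Longrightarrow> eq_upto n (U \<beta>) (V \<beta>)"
  shows "eq_upto (Suc n) (fY \<alpha> * (\<Prod>i\<leftarrow>is. c - mat_vec A (N i) U \<alpha>))
    (fY \<alpha> * (\<Prod>i\<leftarrow>is. c - mat_vec A (N i) V \<alpha>))"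
  using assms
  by (intro eq_upto_var_mult eq_upto_prod_list eq_upto_diff eq_upto_mat_vec eq_upto_refl)

text \<open>If two solutions agree in all components below length \<open>n\<close>, the leading
  \<open>Y\<close> of the equations gives agreement below length \<open>n + 1\<close>.\<close>

lemma solves_system_unique:
  assumes A: "A = (\<Union>k\<in>K. P k)"
    and U: "solves_system K P A c N U" and V: "solves_system K P A c N V" and "\<alpha> \<in> A"
  shows "U \<alpha> = V \<alpha>"
proof (rule eq_upto_all_eq)
  fix n
  show "eq_upto n (U \<alpha>) (V \<alpha>)"
    using \<open>\<alpha> \<in> A\<close>
  proof (induction n arbitrary: \<alpha>)
    case (Suc n)
    then obtain k where k: "k \<in> K" "\<alpha> \<in> P k" using A by blast
    with U V have eqs: "U \<alpha> = fY \<alpha> * (\<Prod>i\<leftarrow>[1..<Suc k]. c - mat_vec A (N k i) U \<alpha>)"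
      "V \<alpha> = fY \<alpha> * (\<Prod>i\<leftarrow>[1..<Suc k]. c - mat_vec A (N k i) V \<alpha>)"
      unfolding solves_system_def by blast+
    show ?case by (subst eqs(1), subst eqs(2)) (rule eq_upto_system[OF Suc.IH])
  qed simp
qed

text \<open>Every word in the support of \<open>V \<alpha>\<close> starts with
  \<open>Y_var \<alpha>\<close>, so a word occurs in at most one component.\<close>

lemma solves_system_locally_finite:
  fixes V :: "'a \<Rightarrow> ('r::{ring, monoid_mult}, 'a indet) ncfps"
  assumes A: "A = (\<Union>k\<in>K. P k)" and V: "solves_system K P A c N V"
  shows "locally_finite V A"
  unfolding locally_finite_def
proof
  fix w
  have "Y_var \<alpha> = hd w" if "\<alpha> \<in> A" "w \<in> support (V \<alpha>)" for \<alpha>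
  proof -
    from that A V obtain f where "V \<alpha> = fY \<alpha> * f"
      unfolding solves_system_def by blast
    with that have "w \<in> support (fY \<alpha> * f)" by simp
    then obtain u v where "w = u @ v" "u \<in> support (fY \<alpha> :: ('r, 'a indet) ncfps)"
      by (rule support_multE)
    with subsetD[OF support_var this(2)] show ?thesis by simp
  qed
  then have "Y_var ` {\<alpha> \<in> A. w \<in> support (V \<alpha>)} \<subseteq> {hd w}" by auto
  then have "finite (Y_var ` {\<alpha> \<in> A. w \<in> support (V \<alpha>)})" by (rule finite_subset) simp
  then show "finite {\<alpha> \<in> A. w \<in> support (V \<alpha>)}"
    by (rule finite_imageD) (simp add: inj_on_def)
qed

text \<open>Both changes add the formal sum of \<open>V\<close>, once to \<open>c\<close> and once
  to the subtracted matrix product, and so cancel in every factor.\<close>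

lemma solves_system_plus_ones:
  assumes "locally_finite V A"
  shows "solves_system K P A (c + formal_sum V A) (\<lambda>k i \<alpha> \<beta>. N k i \<alpha> \<beta> + 1) V \<longleftrightarrow>
    solves_system K P A c N V"
  unfolding solves_system_def by (simp add: mat_vec_plus_ones[OF assms] del: upt_Suc)

text \<open>Substitution respects products and locally finite sums and fixes constants and every
  \<open>Y\<close>, so in the equations only \<open>c\<close> is affected.\<close>

lemma solves_system_ncsubst:
  assumes A: "A = (\<Union>k\<in>K. P k)" and V: "solves_system K P A c N V"
    and adm: "admissible E \<sigma>" and Y: "\<And>\<alpha>. \<sigma> (Y_var \<alpha>) = fY \<alpha>"
  shows "solves_system K P A (ncsubst \<sigma> c) N (\<lambda>\<alpha>. ncsubst \<sigma> (V \<alpha>))"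
  unfolding solves_system_def
proof (intro ballI)
  fix k \<alpha> assume k: "k \<in> K" "\<alpha> \<in> P k"
  note lf = solves_system_locally_finite[OF A V]
  from k V have "V \<alpha> = fY \<alpha> * (\<Prod>i\<leftarrow>[1..<Suc k]. c - mat_vec A (N k i) V \<alpha>)"
    unfolding solves_system_def by blast
  then show "ncsubst \<sigma> (V \<alpha>) =
      fY \<alpha> * (\<Prod>i\<leftarrow>[1..<Suc k]. ncsubst \<sigma> c - mat_vec A (N k i) (\<lambda>\<alpha>. ncsubst \<sigma> (V \<alpha>)) \<alpha>)"
    by (simp only: ncsubst_mult[OF adm] ncsubst_prod_list[OF adm] ncsubst_diff[OF adm]
        mat_vec_ncsubst[OF adm lf] ncsubst_var Y)
qed

section \<open>Existence and uniqueness of solutions\<close>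

lemma XY_series_altdef:
  "XY_series A = {f. support f \<subseteq> {w. set w \<subseteq> insert X_var (Y_var ` A) \<and> X_var \<in> set w \<and>
    (\<exists>\<beta>\<in>A. Y_var \<beta> \<in> set w)}}"
  by (auto simp: XY_series_def support_def)

text \<open>The condition on words survives concatenation. The empty product is excluded because 1
  can have only the empty word in its support.\<close>

lemma support_prod_list_subset:
  assumes "\<And>i. i \<in> set xs \<Longrightarrow> support (F i) \<subseteq> {w. set w \<subseteq> B \<and> x \<in> set w}" "xs \<noteq> []"
  shows "support (\<Prod>i\<leftarrow>xs. F i) \<subseteq> {w. set w \<subseteq> B \<and> x \<in> set w}"
  using assms(2, 1)
proof (induction xs rule: list_nonempty_induct)
  case (single y)
  from single[of y] show ?case by simp
next
  case (cons y ys)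
  show ?case
  proof
    fix w assume "w \<in> support (\<Prod>i\<leftarrow>y # ys. F i)"
    then obtain u v where "w = u @ v" "u \<in> support (F y)" "v \<in> support (\<Prod>i\<leftarrow>ys. F i)"
      by (auto elim: support_multE)
    with cons show "w \<in> {w. set w \<subseteq> B \<and> x \<in> set w}" by fastforce
  qed
qed

lemma ex1_solves_system:
  assumes pos: "\<forall>k\<in>K. 0 < k" and A: "A = (\<Union>k\<in>K. P k)" and disj: "disjoint_family_on P K"
    and c: "support c \<subseteq> {[X_var]}"
  shows "\<exists>!V. V \<in> A \<rightarrow>\<^sub>E XY_series A \<and> solves_system K P A c N V"
proof (rule ex_ex1I)
  \<comment> \<open>The index of the part containing \<open>\<alpha>\<close>, unique by
    disjointness.\<close>
  define \<kappa> where "\<kappa> \<alpha> = (THE k. k \<in> K \<and> \<alpha> \<in> P k)" for \<alpha>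
  have \<kappa>_eq: "\<kappa> \<alpha> = k" if "k \<in> K" "\<alpha> \<in> P k" for k \<alpha>
    unfolding \<kappa>_def using that disj by (intro the_equality) (auto simp: disjoint_family_on_def)
  have \<kappa>_pos: "0 < \<kappa> \<alpha>" if "\<alpha> \<in> A" for \<alpha>
    using that A pos \<kappa>_eq by auto
  \<comment> \<open>The value 0 off \<open>A\<close> keeps the map contracting, and its values in
    \<open>XY_series A\<close>, at every index.\<close>
  define \<Phi> where "\<Phi> V \<alpha> = (if \<alpha> \<in> A
      then fY \<alpha> * (\<Prod>i\<leftarrow>[1..<Suc (\<kappa> \<alpha>)]. c - mat_vec A (N (\<kappa> \<alpha>) i) V \<alpha>) else 0)" for V \<alpha>
  have "eq_upto (Suc n) (\<Phi> U \<alpha>) (\<Phi> V \<alpha>)" if "\<And>\<beta>. eq_upto n (U \<beta>) (V \<beta>)" for n U V \<alpha>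
    using that by (auto simp: \<Phi>_def simp del: upt_Suc intro: eq_upto_system)
  then obtain V where fixed: "\<Phi> V = V" and approx: "\<And>n \<alpha>. eq_upto n (V \<alpha>) ((\<Phi> ^^ n) (\<lambda>_. 0) \<alpha>)"
    using contraction_fixpoint[of \<Phi>] by blast
  let ?B = "insert X_var (Y_var ` A)"
  \<comment> \<open>The leading factor supplies a \<open>Y\<close>; the product, nonempty because
    \<open>0 < \<kappa> \<alpha>\<close>, supplies an \<open>X\<close>.\<close>
  have \<Phi>_XY: "\<Phi> U \<alpha> \<in> XY_series A" if U: "\<And>\<beta>. U \<beta> \<in> XY_series A" for U \<alpha>
  proof (cases "\<alpha> \<in> A")
    case True
    have "support (c - mat_vec A M U \<alpha>) \<subseteq> {w. set w \<subseteq> ?B \<and> X_var \<in> set w}" for M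
    proof -
      have "(\<Union>\<beta>\<in>A. support (U \<beta>)) \<subseteq> {w. set w \<subseteq> ?B \<and> X_var \<in> set w}"
        using U unfolding XY_series_altdef by blast
      moreover have "{[X_var]} \<subseteq> {w. set w \<subseteq> ?B \<and> X_var \<in> set w}" by auto
      ultimately show ?thesis
        by (intro order.trans[OF support_diff] Un_least order.trans[OF c]
            order.trans[OF support_mat_vec])
    qed
    then have prod: "support (\<Prod>i\<leftarrow>[1..<Suc (\<kappa> \<alpha>)]. c - mat_vec A (N (\<kappa> \<alpha>) i) U \<alpha>)
        \<subseteq> {w. set w \<subseteq> ?B \<and> X_var \<in> set w}"
      using \<kappa>_pos[OF True] by (intro support_prod_list_subset) auto
    show ?thesis
      unfolding XY_series_altdef
    proof (intro CollectI subsetI)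
      fix w assume "w \<in> support (\<Phi> U \<alpha>)"
      then obtain u v where "w = u @ v" and u: "u \<in> support (fY \<alpha> :: ('b, 'a indet) ncfps)"
        and v: "v \<in> support (\<Prod>i\<leftarrow>[1..<Suc (\<kappa> \<alpha>)]. c - mat_vec A (N (\<kappa> \<alpha>) i) U \<alpha>)"
        using True by (auto simp: \<Phi>_def simp del: upt_Suc elim: support_multE)
      moreover from u support_var[of "Y_var \<alpha>"] have "u = [Y_var \<alpha>]" by blast
      moreover from v prod have "set v \<subseteq> ?B" "X_var \<in> set v" by blast+
      ultimately show "set w \<subseteq> ?B \<and> X_var \<in> set w \<and> (\<exists>\<beta>\<in>A. Y_var \<beta> \<in> set w)"
        using True by auto
    qed
  qed (simp add: \<Phi>_def XY_series_def)
  have iter_XY: "(\<Phi> ^^ n) (\<lambda>_. 0) \<alpha> \<in> XY_series A" for n \<alpha>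
  proof (induction n arbitrary: \<alpha>)
    case 0
    show ?case by (simp add: XY_series_def)
  next
    case (Suc n)
    then show ?case by (simp add: \<Phi>_XY)
  qed
  \<comment> \<open>Membership is a condition on single coefficients, and at each word
    \<open>V \<alpha>\<close> agrees with a late enough iterate.\<close>
  have V_XY: "V \<alpha> \<in> XY_series A" for \<alpha>
    unfolding XY_series_def
  proof (intro CollectI allI)
    fix w
    have "coeff (V \<alpha>) w = coeff ((\<Phi> ^^ Suc (length w)) (\<lambda>_. 0) \<alpha>) w"
      using approx unfolding eq_upto_def by blast
    then show "coeff (V \<alpha>) w \<noteq> 0 \<longrightarrow>
        set w \<subseteq> ?B \<and> X_var \<in> set w \<and> (\<exists>\<beta>\<in>A. Y_var \<beta> \<in> set w)"
      using iter_XY[of "Suc (length w)" \<alpha>] unfolding XY_series_def by force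
  qed
  \<comment> \<open>Restriction replaces the zeros off \<open>A\<close> by \<open>undefined\<close>,
    as \<open>\<rightarrow>\<^sub>E\<close> demands; \<open>mat_vec\<close> reads only the values on
    \<open>A\<close>.\<close>
  have "solves_system K P A c N (restrict V A)"
    unfolding solves_system_def
  proof (intro ballI)
    fix k \<alpha> assume k: "k \<in> K" "\<alpha> \<in> P k"
    then have "\<alpha> \<in> A" using A by blast
    have "mat_vec A M (restrict V A) \<alpha> = mat_vec A M V \<alpha>" for M
      by (rule mat_vec_cong) simp
    with \<open>\<alpha> \<in> A\<close> fun_cong[OF fixed, of \<alpha>] \<kappa>_eq[OF k]
    show "restrict V A \<alpha> = fY \<alpha> * (\<Prod>i\<leftarrow>[1..<Suc k]. c - mat_vec A (N k i) (restrict V A) \<alpha>)"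
      by (simp add: \<Phi>_def del: upt_Suc)
  qed
  with V_XY show "\<exists>V. V \<in> A \<rightarrow>\<^sub>E XY_series A \<and> solves_system K P A c N V"
    by (intro exI[of _ "restrict V A"]) auto
next
  fix U V
  assume U: "U \<in> A \<rightarrow>\<^sub>E XY_series A \<and> solves_system K P A c N U"
    and V: "V \<in> A \<rightarrow>\<^sub>E XY_series A \<and> solves_system K P A c N V"
  show "U = V"
    by (rule PiE_ext[OF conjunct1[OF U] conjunct1[OF V]])
      (rule solves_system_unique[OF A conjunct2[OF U] conjunct2[OF V]])
qed

section \<open>The two families and their compositions\<close>

lemma is_g_family_iff:
  "is_g_family K P A M V \<longleftrightarrow> V \<in> A \<rightarrow>\<^sub>E XY_series A \<and> solves_system K P A fX M V"
  by (simp add: is_g_family_def solves_system_def)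

text \<open>Since \<open>M - J\<close> is the negative of \<open>J - M\<close>, the factor
  \<open>- X + (J - M) V\<close> equals \<open>- X - (M - J) V\<close>, which has the common form
  with \<open>c = - X\<close>.\<close>

lemma is_g_tilde_family_iff:
  "is_g_tilde_family K P A (\<lambda>k i \<alpha> \<beta>. 1 - M k i \<alpha> \<beta>) V \<longleftrightarrow>
    V \<in> A \<rightarrow>\<^sub>E XY_series A \<and> solves_system K P A (- fX) (\<lambda>k i \<alpha> \<beta>. M k i \<alpha> \<beta> - 1) V"
proof -
  have "mat_vec A (\<lambda>\<alpha> \<beta>. M k i \<alpha> \<beta> - 1) V \<alpha> = - mat_vec A (\<lambda>\<alpha> \<beta>. 1 - M k i \<alpha> \<beta>) V \<alpha>" for k i \<alpha>
    using mat_vec_uminus[of A "\<lambda>\<alpha> \<beta>. 1 - M k i \<alpha> \<beta>" V \<alpha>] by simp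
  then show ?thesis
    by (simp add: is_g_tilde_family_def solves_system_def)
qed

abbreviation X_substitution ::
  "('r::{ring, monoid_mult}, 'a indet) ncfps \<Rightarrow> 'a indet \<Rightarrow> ('r, 'a indet) ncfps" where
  "X_substitution h \<equiv> \<lambda>z. case z of X_var \<Rightarrow> h | Y_var \<alpha> \<Rightarrow> fY \<alpha>"

text \<open>Only \<open>X\<close> can disappear without a trace, since each \<open>Y\<close> is sent
  to itself. The series put for \<open>X\<close> has no constant term, because \<open>- X\<close>
  and all \<open>V \<alpha>\<close> have positive \<open>X\<close>-degree.\<close>

lemma admissible_X_substitution:
  fixes V :: "'a \<Rightarrow> ('r::{ring, monoid_mult}, 'a indet) ncfps"
  assumes "V \<in> A \<rightarrow>\<^sub>E XY_series A"
  shows "admissible {X_var} (X_substitution (- fX + formal_sum V A))"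
proof -
  have "[] \<notin> support (V \<alpha>)" if "\<alpha> \<in> A" for \<alpha>
    using PiE_mem[OF assms that] by (auto simp: XY_series_altdef)
  then have "[] \<notin> support (- fX + formal_sum V A)"
    using support_add[of "- fX" "formal_sum V A"] support_formal_sum[of V A]
      support_var[of X_var] by fastforce
  moreover have "w \<noteq> [] \<and> Y_var \<alpha> \<in> set w" if "w \<in> support (fY \<alpha> :: ('r, 'a indet) ncfps)" for w \<alpha>
    using subsetD[OF support_var that] by simp
  ultimately show ?thesis
    by (auto simp: admissible_def split: indet.splits)
qed

theorem theorem6p1:
  fixes K :: "nat set" and P :: "nat \<Rightarrow> 'a set" and A :: "'a set"
    and M :: "nat \<Rightarrow> nat \<Rightarrow> 'a \<Rightarrow> 'a \<Rightarrow> 'r::{ring, monoid_mult}"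
  assumes K_pos: "\<forall>k\<in>K. 0 < k"
    and A_union: "A = (\<Union>k\<in>K. P k)"
    and P_disjoint: "disjoint_family_on P K"
    and P_nonempty: "\<forall>k\<in>K. P k \<noteq> {}"
  shows "(\<exists>!V. is_g_family K P A M V) \<and>
    (\<exists>!V'. is_g_tilde_family K P A (\<lambda>k i \<alpha> \<beta>. 1 - M k i \<alpha> \<beta>) V') \<and>
    (\<forall>V V'. is_g_family K P A M V \<longrightarrow>
      is_g_tilde_family K P A (\<lambda>k i \<alpha> \<beta>. 1 - M k i \<alpha> \<beta>) V' \<longrightarrow>
      (let g = - fX + formal_sum V A; g' = - fX + formal_sum V' A
       in g \<circ>\<^sub>X g' = fX \<and> g' \<circ>\<^sub>X g = fX))"
proof (intro conjI allI impI)
  show "\<exists>!V. is_g_family K P A M V"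
    unfolding is_g_family_iff
    by (rule ex1_solves_system[OF K_pos A_union P_disjoint]) (rule support_var)
  show "\<exists>!V'. is_g_tilde_family K P A (\<lambda>k i \<alpha> \<beta>. 1 - M k i \<alpha> \<beta>) V'"
    unfolding is_g_tilde_family_iff
    by (rule ex1_solves_system[OF K_pos A_union P_disjoint]) (simp add: support_var)
next
  fix V V'
  assume "is_g_family K P A M V" "is_g_tilde_family K P A (\<lambda>k i \<alpha> \<beta>. 1 - M k i \<alpha> \<beta>) V'"
  then have V: "V \<in> A \<rightarrow>\<^sub>E XY_series A" "solves_system K P A fX M V"
    and V': "V' \<in> A \<rightarrow>\<^sub>E XY_series A" "solves_system K P A (- fX) (\<lambda>k i \<alpha> \<beta>. M k i \<alpha> \<beta> - 1) V'"
    by (simp_all add: is_g_family_iff is_g_tilde_family_iff)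
  note lf = solves_system_locally_finite[OF A_union V(2)]
  note lf' = solves_system_locally_finite[OF A_union V'(2)]
  define g where "g = - fX + formal_sum V A"
  define g' where "g' = - fX + formal_sum V' A"
  note adm = admissible_X_substitution[OF V(1), folded g_def]
  note adm' = admissible_X_substitution[OF V'(1), folded g'_def]
  \<comment> \<open>Substituting \<open>g'\<close> for \<open>X\<close> turns \<open>c = X\<close>
    into \<open>c = g'\<close>.\<close>
  have "solves_system K P A g' M (\<lambda>\<alpha>. ncsubst (X_substitution g') (V \<alpha>))"
    using solves_system_ncsubst[OF A_union V(2) adm'] by simp
  \<comment> \<open>Adding \<open>J\<close> to \<open>M - J\<close> and the sum of \<open>V'\<close>
    to \<open>- X\<close> yields exactly \<open>M\<close> and \<open>g'\<close>.\<close>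
  moreover have "solves_system K P A g' M V'"
    using solves_system_plus_ones[OF lf', of K P "- fX" "\<lambda>k i \<alpha> \<beta>. M k i \<alpha> \<beta> - 1"] V'(2)
    by (simp add: g'_def)
  ultimately have "ncsubst (X_substitution g') (V \<alpha>) = V' \<alpha>" if "\<alpha> \<in> A" for \<alpha>
    using that by (rule solves_system_unique[OF A_union])
  then have "formal_sum (\<lambda>\<alpha>. ncsubst (X_substitution g') (V \<alpha>)) A = formal_sum V' A"
    by (rule formal_sum_cong)
  \<comment> \<open>The term \<open>- X\<close> of \<open>g\<close> becomes \<open>- g'\<close>,
    whose part \<open>- formal_sum V' A\<close> then cancels.\<close>
  then have "g \<circ>\<^sub>X g' = - g' + formal_sum V' A"
    unfolding X_compose_def g_def
    by (simp add: ncsubst_diff[OF adm'] ncsubst_formal_sum[OF adm' lf])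
  then have 1: "g \<circ>\<^sub>X g' = fX" by (simp add: g'_def)
  have "solves_system K P A (- g) (\<lambda>k i \<alpha> \<beta>. M k i \<alpha> \<beta> - 1)
      (\<lambda>\<alpha>. ncsubst (X_substitution g) (V' \<alpha>))"
    using solves_system_ncsubst[OF A_union V'(2) adm] by (simp add: ncsubst_uminus[OF adm])
  \<comment> \<open>Here \<open>- g\<close> plus the sum of \<open>V\<close> is \<open>X\<close>, so
    adding \<open>J\<close> leads back to the system with \<open>X\<close> and \<open>M\<close> that
    \<open>V\<close> solves.\<close>
  moreover have "solves_system K P A (- g) (\<lambda>k i \<alpha> \<beta>. M k i \<alpha> \<beta> - 1) V"
    using solves_system_plus_ones[OF lf, of K P "- g" "\<lambda>k i \<alpha> \<beta>. M k i \<alpha> \<beta> - 1"] V(2)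
    by (simp add: g_def)
  ultimately have "ncsubst (X_substitution g) (V' \<alpha>) = V \<alpha>" if "\<alpha> \<in> A" for \<alpha>
    using that by (rule solves_system_unique[OF A_union])
  then have "formal_sum (\<lambda>\<alpha>. ncsubst (X_substitution g) (V' \<alpha>)) A = formal_sum V A"
    by (rule formal_sum_cong)
  then have "g' \<circ>\<^sub>X g = - g + formal_sum V A"
    unfolding X_compose_def g'_def
    by (simp add: ncsubst_diff[OF adm] ncsubst_formal_sum[OF adm lf'])
  then have "g' \<circ>\<^sub>X g = fX" by (simp add: g_def)
  with 1 have "g \<circ>\<^sub>X g' = fX \<and> g' \<circ>\<^sub>X g = fX" by (rule conjI)
  then show "let g = - fX + formal_sum V A; g' = - fX + formal_sum V' A
      in g \<circ>\<^sub>X g' = fX \<and> g' \<circ>\<^sub>X g = fX"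
    unfolding Let_def g_def g'_def .
qed

end
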